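(* Let $\mathcal{A}$ be a real symmetric $Z$-tensor of even order $m$ and dimension $n$. If $\mathcal{A}$ is positive semi-definite, then its absolute tensor $|\mathcal{A}|$ has an SOS tensor decomposition.
   Context: A real tensor of order $m$ and dimension $n$ is an array $\mathcal{A}=(a_{i_1\cdots i_m})$ with $i_1,\dots,i_m\in[n]=\{1,\dots,n\}$; it is symmetric if its entries are invariant under permutations of the indices. Its associated form is $f_{\mathcal{A}}(\mathbf{x})=\mathcal{A}\mathbf{x}^m=\sum_{i_1,\dots,i_m\in[n]}a_{i_1\cdots i_m}x_{i_1}\cdots x_{i_m}$. $\mathcal{A}$ is positive semi-definite if $f_{\mathcal{A}}(\mathbf{x})\ge0$ for all $\mathbf{x}\in\mathbb{R}^n$. For even $m$, a tensor has an SOS tensor decomposition if its associated form is a finite sum of squares of real polynomials. $\mathcal{A}$ is a $Z$-tensor if all its off-diagonal entries (those whose indices are not all equal) are non-positive; then $\mathcal{A}=\mathcal{D}-\mathcal{C}$, where $\mathcal{D}$ is the diagonal tensor with $i$th diagonal entry $a_{ii\cdots i}$ and $\mathcal{C}$ is an entrywise nonnegative tensor with zero diagonal entries. The absolute tensor is $|\mathcal{A}|=|\mathcal{D}|+\mathcal{C}$, where $|\mathcal{D}|$ is the entrywise absolute value of $\mathcal{D}$. *)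

theory Defs
  imports "HOL-Analysis.Analysis"
begin

text \<open>
  A real tensor of order \<open>m = CARD('m)\<close> and dimension \<open>n = CARD('n)\<close> is a function on
  multi-indices, a multi-index \<open>i\<^sub>1 \<dots> i\<^sub>m\<close> being a function \<open>'m \<Rightarrow> 'n\<close>.
\<close>

type_synonym ('m, 'n) tensor = "('m \<Rightarrow> 'n) \<Rightarrow> real"

definition symmetric_tensor :: "('m, 'n) tensor \<Rightarrow> bool" where
  "symmetric_tensor A \<longleftrightarrow> (\<forall>p i. bij p \<longrightarrow> A (i \<circ> p) = A i)"

definition tensor_form :: "('m::finite, 'n::finite) tensor \<Rightarrow> real ^ 'n \<Rightarrow> real" where
  "tensor_form A x = (\<Sum>i\<in>UNIV. A i * (\<Prod>k\<in>UNIV. x $ i k))"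

definition psd_tensor :: "('m::finite, 'n::finite) tensor \<Rightarrow> bool" where
  "psd_tensor A \<longleftrightarrow> (\<forall>x. 0 \<le> tensor_form A x)"

text \<open>
  Real polynomials in \<open>x\<^sub>1, \<dots>, x\<^sub>n\<close> are taken as polynomial functions on \<open>real ^ 'n\<close>; since
  the reals are infinite, an identity of such functions is an identity of polynomials.
\<close>

definition has_sos_decomposition :: "('m::finite, 'n::finite) tensor \<Rightarrow> bool" where
  "has_sos_decomposition A \<longleftrightarrow>
     (\<exists>(r::nat) (g :: nat \<Rightarrow> real ^ 'n \<Rightarrow> real).
        (\<forall>j<r. real_polynomial_function (g j)) \<and>
        (\<forall>x. tensor_form A x = (\<Sum>j<r. (g j x)\<^sup>2)))"

definition diagonal_index :: "('m \<Rightarrow> 'n) \<Rightarrow> bool" where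
  "diagonal_index i \<longleftrightarrow> (\<forall>k l. i k = i l)"

definition Z_tensor :: "('m, 'n) tensor \<Rightarrow> bool" where
  "Z_tensor A \<longleftrightarrow> (\<forall>i. \<not> diagonal_index i \<longrightarrow> A i \<le> 0)"

definition diag_part :: "('m, 'n) tensor \<Rightarrow> ('m, 'n) tensor" where
  "diag_part A = (\<lambda>i. if diagonal_index i then A i else 0)"

text \<open>
  With \<open>D = diag_part A\<close> and \<open>A = D - C\<close>, the absolute tensor is \<open>|D| + C\<close>.  It agrees with
  the entrywise absolute value of \<open>A\<close> when \<open>A\<close> is a Z-tensor.
\<close>

definition neg_offdiag_part :: "('m, 'n) tensor \<Rightarrow> ('m, 'n) tensor" where
  "neg_offdiag_part A = (\<lambda>i. diag_part A i - A i)"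

definition abs_tensor :: "('m, 'n) tensor \<Rightarrow> ('m, 'n) tensor" where
  "abs_tensor A = (\<lambda>i. \<bar>diag_part A i\<bar> + neg_offdiag_part A i)"

end

theory Submission imports Defs begin

text \<open>
  Write \<open>f\<^sub>A(x) = \<Sum>\<^sub>i d\<^sub>i x\<^sub>i\<^sup>m - \<Sum>\<^sub>I c\<^sub>I x\<^sub>I\<close> with \<open>x\<^sub>I = \<Prod>\<^sub>k x\<^bsub>I k\<^esub>\<close> and \<open>c \<ge> 0\<close>.  Nonnegativity of \<open>f\<^sub>A\<close>
  yields weights \<open>b\<^bsub>I,k\<^esub> \<ge> 0\<close> with \<open>\<Prod>\<^sub>k b\<^bsub>I,k\<^esub> = c\<^sub>I\<^sup>m\<close> such that the total weight of the pairs \<open>(I, k)\<close> with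
  \<open>I k = i\<close> is at most \<open>m d\<^sub>i\<close>.  Splitting the diagonal of \<open>|A|\<close> accordingly leaves nonnegative multiples
  of the \<open>x\<^sub>i\<^sup>m\<close> and, for every \<open>I\<close>, an expression \<open>1/m \<Sum>\<^sub>k y\<^sub>k\<^sup>m + \<Prod>\<^sub>k y\<^sub>k\<close> with
  \<open>y\<^sub>k = b\<^bsub>I,k\<^esub>\<^bsup>1/m\<^esup> x\<^bsub>I k\<^esub>\<close>, which is a sum of squares by Hurwitz's form of the arithmetic-geometric
  mean inequality.

  If \<open>c > 0\<close>, a minimiser \<open>u\<close> of \<open>f\<^sub>A(x) / \<Sum>\<^sub>i x\<^sub>i\<^sup>m\<close> on the nonnegative orthant is positive (Perron-Frobenius),
  and \<open>b\<^bsub>I,k\<^esub> = c\<^sub>I u\<^sub>I / u\<^bsub>I k\<^esub>\<^sup>m\<close> works.  The general case follows by perturbing \<open>c\<close>: the weights stay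
  in a compact set, and the conditions on them are closed.
\<close>

section \<open>Sums of squares of polynomials and their closure properties\<close>

text \<open>Adding one square at a time lets closure under sums and products be proved by induction;
  \<open>sos_imp_sum_squares\<close> translates back to explicit finite sums.\<close>

inductive_set sos :: "('a::real_normed_vector \<Rightarrow> real) set" where
  sos_zero: "(\<lambda>x. 0) \<in> sos"
| sos_add_square: "f \<in> sos \<Longrightarrow> real_polynomial_function p \<Longrightarrow> (\<lambda>x. (p x)\<^sup>2 + f x) \<in> sos"

lemma sos_square: "real_polynomial_function p \<Longrightarrow> (\<lambda>x. (p x)\<^sup>2) \<in> sos"
  using sos_add_square[OF sos_zero] by simp

lemma sos_const: "0 \<le> c \<Longrightarrow> (\<lambda>x. c) \<in> sos"
  using sos_square[OF real_polynomial_function.intros(2)[of "sqrt c"]] by simp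

lemma sos_polynomial: "f \<in> sos \<Longrightarrow> real_polynomial_function f"
  by (induction rule: sos.induct) auto

lemma sos_add:
  assumes "f \<in> sos" "g \<in> sos"
  shows "(\<lambda>x. f x + g x) \<in> sos"
  using assms
proof (induction rule: sos.induct)
  case (sos_add_square f p)
  then have "(\<lambda>x. (p x)\<^sup>2 + (f x + g x)) \<in> sos"
    by (intro sos.sos_add_square) auto
  then show ?case by (simp add: add.assoc)
qed simp

lemma sos_mult:
  assumes "f \<in> sos" "g \<in> sos"
  shows "(\<lambda>x. f x * g x) \<in> sos"
  using assms
proof (induction rule: sos.induct)
  case (sos_add_square f p)
  have "(\<lambda>x. (p x)\<^sup>2 * g x) \<in> sos"
    using \<open>g \<in> sos\<close>
  proof (induction rule: sos.induct)
    case (sos_add_square g q)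
    then have "(\<lambda>x. (p x * q x)\<^sup>2 + (p x)\<^sup>2 * g x) \<in> sos"
      using \<open>real_polynomial_function p\<close> by (intro sos.sos_add_square) auto
    then show ?case by (simp add: algebra_simps power_mult_distrib)
  qed (simp add: sos.sos_zero)
  then show ?case
    using sos_add[of "\<lambda>x. (p x)\<^sup>2 * g x" "\<lambda>x. f x * g x"] sos_add_square
    by (simp add: algebra_simps)
qed (simp add: sos.sos_zero)

lemma sos_cmult: "0 \<le> c \<Longrightarrow> f \<in> sos \<Longrightarrow> (\<lambda>x. c * f x) \<in> sos"
  by (rule sos_mult[OF sos_const])

lemma sos_power: "f \<in> sos \<Longrightarrow> (\<lambda>x. f x ^ n) \<in> sos"
  by (induction n) (auto intro: sos_mult sos_const)

lemma sos_sum: "(\<And>i. i \<in> S \<Longrightarrow> f i \<in> sos) \<Longrightarrow> (\<lambda>x. \<Sum>i\<in>S. f i x) \<in> sos"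
  by (induction S rule: infinite_finite_induct) (auto intro: sos_add sos_zero)

lemma sos_imp_sum_squares:
  assumes "f \<in> sos"
  shows "\<exists>(r::nat) g. (\<forall>j<r. real_polynomial_function (g j)) \<and> (\<forall>x. f x = (\<Sum>j<r. (g j x)\<^sup>2))"
  using assms
proof (induction rule: sos.induct)
  case sos_zero
  show ?case by (intro exI[of _ 0]) simp
next
  case (sos_add_square f p)
  then obtain r :: nat and g where "\<forall>j<r. real_polynomial_function (g j)"
    "\<forall>x. f x = (\<Sum>j<r. (g j x)\<^sup>2)" by blast
  then show ?case
    using \<open>real_polynomial_function p\<close>
    by (intro exI[of _ "Suc r"] exI[of _ "g(r := p)"]) (auto simp: less_Suc_eq)
qed

section \<open>The arithmetic-geometric mean inequality as a sum of squares\<close>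

text \<open>Factoring \<open>s - t\<close> out of \<open>s ^ k - t ^ k\<close> leaves
  \<open>(s - t)\<^sup>2\<close> times a sum of products of powers of \<open>s\<close> and
  \<open>t\<close>.\<close>

lemma sos_power_diff_mult_diff:
  assumes "s \<in> sos" "t \<in> sos"
  shows "(\<lambda>x. (s x ^ k - t x ^ k) * (s x - t x)) \<in> sos"
proof (cases k)
  case 0
  then show ?thesis by (simp add: sos_zero)
next
  case (Suc n)
  have "(\<lambda>x. (s x - t x)\<^sup>2 * (\<Sum>p<Suc n. s x ^ p * t x ^ (n - p))) \<in> sos"
    using assms by (intro sos_mult sos_square sos_sum sos_power) (auto intro: sos_polynomial)
  also have "(\<lambda>x. (s x - t x)\<^sup>2 * (\<Sum>p<Suc n. s x ^ p * t x ^ (n - p)))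
      = (\<lambda>x. (s x ^ k - t x ^ k) * (s x - t x))"
    unfolding Suc diff_power_eq_sum by (simp only: power2_eq_square mult_ac)
  finally show ?thesis .
qed

text \<open>The induction step averages the inequality for \<open>S - {j}\<close>, multiplied by \<open>t j\<close>, over all
  \<open>j \<in> S\<close>; the error terms pair up to \<open>(t\<^sub>i\<^sup>k - t\<^sub>j\<^sup>k)(t\<^sub>i - t\<^sub>j)\<close>.\<close>

lemma sos_arith_geo_mean:
  assumes "finite S" "\<And>i. i \<in> S \<Longrightarrow> t i \<in> sos"
  shows "(\<lambda>x. (\<Sum>i\<in>S. t i x ^ card S) - real (card S) * (\<Prod>i\<in>S. t i x)) \<in> sos"
  using assms
proof (induction "card S" arbitrary: S)
  case 0
  then show ?case by (simp add: sos_zero)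
next
  case (Suc k)
  show ?case
  \<comment> \<open>The averaging divides by \<open>k\<close>, so singletons are treated
    apart.\<close>
  proof (cases "k = 0")
    case True
    then obtain a where "S = {a}" using Suc.hyps by (metis One_nat_def card_1_singletonE)
    then show ?thesis by (simp add: sos_zero)
  next
    case False
    define E where "E j x = t j x * ((\<Sum>i\<in>S-{j}. t i x ^ k) - real k * (\<Prod>i\<in>S-{j}. t i x))" for j x
    define D where "D i j x = (t i x ^ k - t j x ^ k) * (t i x - t j x)" for i j x
    have "E j \<in> sos" if "j \<in> S" for j
    proof -
      have "card (S - {j}) = k" using that Suc.hyps Suc.prems by simp
      then show ?thesis
        using Suc.hyps(1)[of "S - {j}"] Suc.prems that unfolding E_def
        by (auto intro!: sos_mult)
    qed
    moreover have "D i j \<in> sos" if "i \<in> S" "j \<in> S" for i j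
      unfolding D_def using Suc.prems that by (intro sos_power_diff_mult_diff) auto
    ultimately have sos: "(\<lambda>x. (1 / k) * ((\<Sum>j\<in>S. E j x) + (1/2) * (\<Sum>i\<in>S. \<Sum>j\<in>S. D i j x))) \<in> sos"
      by (intro sos_cmult sos_add sos_sum) auto
    \<comment> \<open>The factor 1/2 undoes counting each pair twice. The products of the first and
      \<open>k\<close>-th power sums then cancel, leaving \<open>k\<close> times the target.\<close>
    have eq: "(1 / k) * ((\<Sum>j\<in>S. E j x) + (1/2) * (\<Sum>i\<in>S. \<Sum>j\<in>S. D i j x))
        = (\<Sum>i\<in>S. t i x ^ card S) - real (card S) * (\<Prod>i\<in>S. t i x)" for x
    proof -
      let ?P = "\<Prod>i\<in>S. t i x" and ?S = "\<lambda>n. \<Sum>i\<in>S. t i x ^ n"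
      have E: "E j x = t j x * ?S k - t j x ^ Suc k - k * ?P" if "j \<in> S" for j
        using that Suc.prems(1)
        by (simp add: E_def sum_diff1 prod.remove[of S j] algebra_simps)
      have "(\<Sum>j\<in>S. E j x) = (\<Sum>j\<in>S. t j x * ?S k - t j x ^ Suc k - k * ?P)"
        by (rule sum.cong) (simp_all only: E)
      also have "\<dots> = ?S 1 * ?S k - ?S (Suc k) - Suc k * (k * ?P)"
        using Suc.hyps(2) by (simp add: sum_subtractf sum_distrib_right)
      finally have 1: "(\<Sum>j\<in>S. E j x) = ?S 1 * ?S k - ?S (Suc k) - Suc k * (k * ?P)" .
      have "(\<Sum>i\<in>S. \<Sum>j\<in>S. D i j x) =
          (\<Sum>i\<in>S. \<Sum>j\<in>S. t i x ^ Suc k + t j x ^ Suc k - t i x ^ k * t j x - t i x * t j x ^ k)"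
        by (intro sum.cong refl) (simp add: D_def algebra_simps)
      also have "\<dots> = 2 * Suc k * ?S (Suc k) - 2 * (?S 1 * ?S k)"
        using Suc.hyps(2)
        by (simp add: sum_subtractf sum.distrib flip: sum_distrib_left sum_distrib_right)
      finally have 2: "(\<Sum>i\<in>S. \<Sum>j\<in>S. D i j x) = 2 * Suc k * ?S (Suc k) - 2 * (?S 1 * ?S k)" .
      show ?thesis
        unfolding 1 2 Suc.hyps(2)[symmetric] using False by (simp add: field_simps)
    qed
    show ?thesis using sos unfolding eq .
  qed
qed

text \<open>Evenness splits the positions into halves \<open>S\<close> and \<open>- S\<close>. The
  mean inequality for the squares \<open>(p k x)\<^sup>2\<close> on each half leaves a deficit of
  half the two squared partial products; half the square of the sum of the partial products restores
  it and contributes the full product as cross term.\<close>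

lemma sos_mean_add_prod:
  fixes p :: "'m::finite \<Rightarrow> 'a::real_normed_vector \<Rightarrow> real"
  assumes "even CARD('m)" "\<And>k. real_polynomial_function (p k)"
  shows "(\<lambda>x. (\<Sum>k\<in>UNIV. p k x ^ CARD('m)) / CARD('m) + (\<Prod>k\<in>UNIV. p k x)) \<in> sos"
proof -
  obtain h where h: "CARD('m) = 2 * h" using assms(1) by blast
  then have "h > 0" using zero_less_card_finite[where 'a='m] by simp
  obtain S :: "'m set" where S: "card S = h"
    using obtain_subset_with_card_n[of h "UNIV :: 'm set"] h by auto
  have T: "card (- S) = h" using S h by (simp add: card_Diff_subset Compl_eq_Diff_UNIV)
  define M where "M R x = (\<Sum>k\<in>R. ((p k x)\<^sup>2) ^ h) - h * (\<Prod>k\<in>R. (p k x)\<^sup>2)" for R x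
  have "M R \<in> sos" if "card R = h" for R
    using sos_arith_geo_mean[of R "\<lambda>k x. (p k x)\<^sup>2"] that unfolding M_def
    by (auto intro: sos_square assms)
  then have sos: "(\<lambda>x. (1 / CARD('m)) * (M S x + M (- S) x)
      + (1/2) * ((\<Prod>k\<in>S. p k x) + (\<Prod>k\<in>-S. p k x))\<^sup>2) \<in> sos"
    using S T assms(2)
    by (intro sos_add sos_cmult sos_square real_polynomial_function.intros(3) real_polynomial_function_prod) auto
  have eq: "(1 / CARD('m)) * (M S x + M (- S) x) + (1/2) * ((\<Prod>k\<in>S. p k x) + (\<Prod>k\<in>-S. p k x))\<^sup>2
      = (\<Sum>k\<in>UNIV. p k x ^ CARD('m)) / CARD('m) + (\<Prod>k\<in>UNIV. p k x)" for x
  proof -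
    have U: "UNIV = S \<union> - S" by auto
    have s: "(\<Sum>k\<in>UNIV. p k x ^ CARD('m)) = (\<Sum>k\<in>S. ((p k x)\<^sup>2) ^ h) + (\<Sum>k\<in>-S. ((p k x)\<^sup>2) ^ h)"
      unfolding h power_mult by (subst U, subst sum.union_disjoint) auto
    have p: "(\<Prod>k\<in>UNIV. p k x) = (\<Prod>k\<in>S. p k x) * (\<Prod>k\<in>-S. p k x)"
      by (subst U, subst prod.union_disjoint) auto
    show ?thesis
      unfolding s p M_def using \<open>h > 0\<close>
      by (simp add: h prod.distrib field_simps power2_eq_square)
  qed
  show ?thesis using sos unfolding eq .
qed

section \<open>Weights from nonnegativity on the orthant\<close>

text \<open>Each factor is at most the largest coordinate, whose power is one of the summands. This
  controls the perturbation of \<open>c\<close> below.\<close>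

lemma prod_le_sum_power:
  fixes x :: "'n::finite \<Rightarrow> real" and I :: "'m::finite \<Rightarrow> 'n"
  assumes "\<And>i. 0 \<le> x i"
  shows "(\<Prod>k\<in>UNIV. x (I k)) \<le> (\<Sum>i\<in>UNIV. x i ^ CARD('m))"
proof -
  define M where "M = Max (range x)"
  have le: "x i \<le> M" for i unfolding M_def by (intro Max_ge) auto
  obtain i where i: "M = x i"
    using Max_in[of "range x"] unfolding M_def by fastforce
  have "(\<Prod>k\<in>UNIV. x (I k)) \<le> (\<Prod>k\<in>(UNIV::'m set). M)"
    using assms le by (intro prod_mono) auto
  also have "\<dots> = x i ^ CARD('m)" by (simp add: i)
  also have "\<dots> \<le> (\<Sum>i\<in>UNIV. x i ^ CARD('m))"
    using assms by (intro member_le_sum) auto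
  finally show ?thesis .
qed

text \<open>The weights certify the inequality termwise: on the orthant, the mean inequality bounds
  each monomial of \<open>c\<close> by the average over \<open>k\<close> of
  \<open>b I k * x $ I k ^ CARD('m)\<close>, and the last condition fits these bounds into the
  diagonal.\<close>

lemma weights_of_positive_tensor:
  fixes c :: "('m::finite, 'n::finite) tensor" and d :: "'n \<Rightarrow> real"
  assumes m: "2 \<le> CARD('m)" and c: "\<And>I. 0 < c I"
    and nonneg: "\<And>x. (\<And>i. 0 \<le> x $ i) \<Longrightarrow> tensor_form c x \<le> (\<Sum>i\<in>UNIV. d i * x $ i ^ CARD('m))"
  shows "\<exists>b. (\<forall>I k. 0 \<le> b I k) \<and> (\<forall>I. (\<Prod>k\<in>UNIV. b I k) = c I ^ CARD('m)) \<and>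
    (\<forall>i. (\<Sum>I\<in>UNIV. \<Sum>k\<in>UNIV. of_bool (I k = i) * b I k) \<le> CARD('m) * d i)"
proof -
  let ?m = "CARD('m)"
  define G :: "real ^ 'n \<Rightarrow> real" where "G x = (\<Sum>i\<in>UNIV. x $ i ^ ?m)" for x
  define F :: "real ^ 'n \<Rightarrow> real" where "F x = (\<Sum>i\<in>UNIV. d i * x $ i ^ ?m) - tensor_form c x" for x
  \<comment> \<open>\<open>F\<close> and \<open>G\<close> are homogeneous of the same degree, so
    their ratio can be minimised on this compact slice of the orthant.\<close>
  define K :: "(real ^ 'n) set" where "K = sphere 0 1 \<inter> {x. \<forall>i. 0 \<le> x $ i}"
  have G_pos: "0 < G x" if "x \<noteq> 0" "\<And>i. 0 \<le> x $ i" for x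
  proof -
    obtain i where "x $ i \<noteq> 0" using \<open>x \<noteq> 0\<close> by (auto simp: vec_eq_iff)
    then show ?thesis unfolding G_def using that(2)
      by (intro sum_pos2[of _ i]) (auto simp: less_le)
  qed
  have G_hom: "G (a *\<^sub>R x) = a ^ ?m * G x" for a x
    by (simp add: G_def power_mult_distrib sum_distrib_left)
  have F_hom: "F (a *\<^sub>R x) = a ^ ?m * F x" for a x
    by (simp add: F_def tensor_form_def power_mult_distrib prod.distrib sum_distrib_left algebra_simps)
  have "closed {x::real^'n. \<forall>i. 0 \<le> x $ i}"
    by (intro closed_Collect_all closed_Collect_le continuous_intros)
  then have "compact K"
    unfolding K_def by (intro compact_Int_closed) auto
  moreover have "axis (undefined::'n) 1 \<in> K"
    by (auto simp: K_def axis_def norm_axis_1[unfolded axis_def])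
  then have "K \<noteq> {}" by blast
  moreover have "continuous_on K (\<lambda>x. F x / G x)"
  proof (intro continuous_on_divide ballI)
    show "G x \<noteq> 0" if "x \<in> K" for x using G_pos[of x] that by (force simp: K_def)
    show "continuous_on K F" "continuous_on K G"
      unfolding F_def G_def tensor_form_def by (intro continuous_intros)+
  qed
  ultimately have "\<exists>u\<in>K. \<forall>x\<in>K. F u / G u \<le> F x / G x"
    by (rule continuous_attains_inf)
  then obtain u where u: "u \<in> K" "\<And>x. x \<in> K \<Longrightarrow> F u / G u \<le> F x / G x"
    by blast
  define \<mu> where "\<mu> = F u / G u"
  have u0: "0 \<le> u $ i" for i using u(1) by (simp add: K_def)
  have "u \<noteq> 0" using u(1) by (auto simp: K_def)
  have Gu: "0 < G u" using G_pos \<open>u \<noteq> 0\<close> u0 by blast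
  have "0 \<le> F u" using nonneg[of u] u0 by (simp add: F_def)
  then have mu0: "0 \<le> \<mu>" using Gu by (simp add: \<mu>_def)
  have Fmu: "\<mu> * G x \<le> F x" if x: "\<And>i. 0 \<le> x $ i" for x
  proof (cases "x = 0")
    case True
    then show ?thesis by (simp add: F_def G_def tensor_form_def zero_power card_gt_0_iff)
  next
    case False
    define y where "y = x /\<^sub>R norm x"
    have xy: "x = norm x *\<^sub>R y" using False by (simp add: y_def)
    have "y \<in> K" using False x by (simp add: K_def y_def)
    then have "\<mu> \<le> F y / G y" and "0 < G y"
      using u(2) G_pos[of y] by (force simp: \<mu>_def K_def)+
    then have "\<mu> * G y \<le> F y" by (simp add: field_simps)
    then show ?thesis
      using mult_left_mono[of "\<mu> * G y" "F y" "norm x ^ ?m"] by (subst (1 2) xy) (simp add: F_hom G_hom mult_ac)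
  qed
  \<comment> \<open>\<open>P j\<close> is the derivative of \<open>tensor_form c\<close> at \<open>u\<close> in direction \<open>j\<close>.  Since \<open>F - \<mu> G\<close> is nonnegative
    on the orthant and vanishes at \<open>u\<close>, its one-sided derivatives there are nonnegative.\<close>
  define P where "P j = (\<Sum>I\<in>UNIV. c I * (\<Sum>k\<in>UNIV. of_bool (I k = j) * (\<Prod>l\<in>UNIV-{k}. u $ I l)))" for j
  have P: "P j \<le> ?m * (d j - \<mu>) * u $ j ^ (?m - 1)" for j
  proof (rule ccontr)
    assume "\<not> ?thesis"
    then have neg: "?m * (d j - \<mu>) * u $ j ^ (?m - 1) - P j < 0" by simp
    \<comment> \<open>This is \<open>F - \<mu> G\<close> on the line through \<open>u\<close> in
      direction \<open>j\<close>. Only t > 0 is used, since \<open>u\<close> might lie on the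
      boundary of the orthant.\<close>
    define \<phi> where "\<phi> t = (\<Sum>i\<in>UNIV. (d i - \<mu>) * (u $ i + t * of_bool (i = j)) ^ ?m)
      - (\<Sum>I\<in>UNIV. c I * (\<Prod>k\<in>UNIV. (u $ I k + t * of_bool (I k = j))))" for t
    have phi: "\<phi> t = F (u + t *\<^sub>R axis j 1) - \<mu> * G (u + t *\<^sub>R axis j 1)" for t
    proof -
      have "axis j 1 $ i = (of_bool (i = j) :: real)" for i
        by (simp add: axis_def)
      then show ?thesis
        by (simp add: \<phi>_def F_def G_def tensor_form_def sum_distrib_left sum_subtractf algebra_simps)
    qed
    have "(\<phi> has_real_derivative
        (\<Sum>i\<in>UNIV. (d i - \<mu>) * (?m * (u $ i + 0 * of_bool (i = j)) ^ (?m - 1) * of_bool (i = j)))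
      - (\<Sum>I\<in>UNIV. c I * (\<Sum>k\<in>UNIV. of_bool (I k = j) * (\<Prod>l\<in>UNIV-{k}. u $ I l + 0 * of_bool (I l = j))))) (at 0)"
      unfolding \<phi>_def by (auto intro!: derivative_eq_intros has_field_derivative_prod simp: mult_ac)
    also have "(\<Sum>i\<in>UNIV. (d i - \<mu>) * (?m * (u $ i + 0 * of_bool (i = j)) ^ (?m - 1) * of_bool (i = j)))
      = ?m * (d j - \<mu>) * u $ j ^ (?m - 1)"
      by (simp add: of_bool_def if_distrib cong: if_cong)
    finally have "(\<phi> has_real_derivative (?m * (d j - \<mu>) * u $ j ^ (?m - 1) - P j)) (at 0)"
      unfolding P_def by simp
    from DERIV_neg_dec_right[OF this neg] obtain e where "e > 0"
      "\<And>h. 0 < h \<Longrightarrow> h < e \<Longrightarrow> \<phi> (0 + h) < \<phi> 0" by blast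
    then have "\<phi> (e / 2) < \<phi> 0" by (metis add_0 field_sum_of_halves half_gt_zero less_add_same_cancel1)
    moreover have "\<phi> 0 = 0" using Gu by (simp add: phi \<mu>_def)
    moreover have "0 \<le> \<phi> (e / 2)"
      unfolding phi using Fmu[of "u + (e / 2) *\<^sub>R axis j 1"] u0 \<open>e > 0\<close> by (simp add: axis_def)
    ultimately show False by simp
  qed
  have u_pos: "0 < u $ j" for j
  proof (rule ccontr)
    assume "\<not> 0 < u $ j"
    then have "u $ j = 0" using u0[of j] by simp
    \<comment> \<open>The exponent \<open>?m - 1\<close> is positive, so the bound on
      \<open>P j\<close> vanishes.\<close>
    then have "P j \<le> 0" using P[of j] m by (simp add: zero_power)
    obtain i where "u $ i \<noteq> 0" using \<open>u \<noteq> 0\<close> by (auto simp: vec_eq_iff)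
    then have i: "0 < u $ i" using u0[of i] by simp
    \<comment> \<open>Exactly one position, arbitrarily \<open>undefined\<close>, carries
      \<open>j\<close>; differentiating there leaves only factors \<open>u $ i > 0\<close>, and
      \<open>c I > 0\<close> makes \<open>P j\<close> positive.\<close>
    define I :: "'m \<Rightarrow> 'n" where "I = (\<lambda>_. i)(undefined := j)"
    have nn: "0 \<le> of_bool (J k = j) * (\<Prod>l\<in>UNIV-{k}. u $ J l)" for J :: "'m \<Rightarrow> 'n" and k
      using u0 by (auto intro: prod_nonneg)
    have "0 < (\<Sum>k\<in>UNIV. of_bool (I k = j) * (\<Prod>l\<in>UNIV-{k}. u $ I l))"
    proof (rule sum_pos2[of _ undefined])
      show "0 < of_bool (I undefined = j) * (\<Prod>l\<in>UNIV-{undefined}. u $ I l)"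
        using i by (auto simp: I_def intro!: prod_pos)
    qed (use nn in auto)
    then have "0 < P j"
      unfolding P_def using c nn
      by (intro sum_pos2[of _ I] mult_nonneg_nonneg sum_nonneg mult_pos_pos) (auto intro: less_imp_le prod_nonneg u0)
    then show False using \<open>P j \<le> 0\<close> by simp
  qed
  \<comment> \<open>The powers of \<open>u\<close> cancel in the product over \<open>k\<close>.
    Where \<open>I k = j\<close>, one factor \<open>u $ j\<close> cancels, so the total weight at
    \<open>j\<close> is \<open>P j / u $ j ^ (?m - 1)\<close>.\<close>
  define b where "b I k = c I * (\<Prod>l\<in>UNIV. u $ I l) / u $ I k ^ ?m" for I k
  show ?thesis
  proof (intro exI[of _ b] conjI allI)
    show "0 \<le> b I k" for I k
      using c[of I] u0 by (simp add: b_def prod_nonneg)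
    have "(\<Prod>l\<in>UNIV. u $ I l) \<noteq> 0" for I :: "'m \<Rightarrow> 'n"
      using u_pos by (simp add: less_imp_neq[symmetric])
    then show "(\<Prod>k\<in>UNIV. b I k) = c I ^ ?m" for I
      by (simp add: b_def prod_dividef prod_power_distrib[symmetric] power_mult_distrib)
    show "(\<Sum>I\<in>UNIV. \<Sum>k\<in>UNIV. of_bool (I k = j) * b I k) \<le> ?m * d j" for j
    proof -
      have "of_bool (I k = j) * b I k = c I * (of_bool (I k = j) * (\<Prod>l\<in>UNIV-{k}. u $ I l)) / u $ j ^ (?m - 1)"
        for I k
      proof -
        have "u $ j ^ ?m = u $ j * u $ j ^ (?m - 1)" by (simp add: power_eq_if)
        then show ?thesis
          using u_pos[of j] by (auto simp: b_def prod.remove[of UNIV k])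
      qed
      then have "(\<Sum>I\<in>UNIV. \<Sum>k\<in>UNIV. of_bool (I k = j) * b I k) = P j / u $ j ^ (?m - 1)"
        by (simp only: P_def sum_distrib_left sum_divide_distrib)
      also have "\<dots> \<le> ?m * (d j - \<mu>)"
        using P[of j] u_pos[of j] by (simp add: divide_le_eq)
      also have "\<dots> \<le> ?m * d j" using mu0 by simp
      finally show ?thesis .
    qed
  qed
qed

lemma weights_of_nonneg_tensor:
  fixes c :: "('m::finite, 'n::finite) tensor" and d :: "'n \<Rightarrow> real"
  assumes m: "2 \<le> CARD('m)" and c: "\<And>I. 0 \<le> c I"
    and nonneg: "\<And>x. (\<And>i. 0 \<le> x $ i) \<Longrightarrow> tensor_form c x \<le> (\<Sum>i\<in>UNIV. d i * x $ i ^ CARD('m))"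
  shows "\<exists>b. (\<forall>I k. 0 \<le> b I k) \<and> (\<forall>I. (\<Prod>k\<in>UNIV. b I k) = c I ^ CARD('m)) \<and>
    (\<forall>i. (\<Sum>I\<in>UNIV. \<Sum>k\<in>UNIV. of_bool (I k = i) * b I k) \<le> CARD('m) * d i)"
proof -
  let ?m = "CARD('m)"
  \<comment> \<open>Raising every entry of \<open>c\<close> by \<delta> adds at most \<delta> times
    \<open>N\<close> times the sum of the powers, one share per multi-index; raising each
    \<open>d i\<close> by \<open>N * \<delta>\<close> absorbs this.\<close>
  define N where "N = real CARD('m \<Rightarrow> 'n)"
  define \<delta> where "\<delta> n = inverse (real (Suc n))" for n
  have \<delta>: "0 < \<delta> n" "\<delta> n \<le> 1" for n by (auto simp: \<delta>_def field_simps)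
  have \<delta>0: "\<delta> \<longlonglongrightarrow> 0" unfolding \<delta>_def by (rule LIMSEQ_inverse_real_of_nat)
  have "\<exists>b. (\<forall>I k. 0 \<le> b I k) \<and> (\<forall>I. (\<Prod>k\<in>UNIV. b I k) = (c I + \<delta> n) ^ ?m) \<and>
    (\<forall>i. (\<Sum>I\<in>UNIV. \<Sum>k\<in>UNIV. of_bool (I k = i) * b I k) \<le> ?m * (d i + N * \<delta> n))" for n
  proof (rule weights_of_positive_tensor[OF m])
    show "0 < c I + \<delta> n" for I using c[of I] \<delta>[of n] by simp
    fix x :: "real ^ 'n"
    assume x: "\<And>i. 0 \<le> x $ i"
    have "(\<Sum>I\<in>(UNIV::('m \<Rightarrow> 'n) set). \<Prod>k\<in>UNIV. x $ I k) \<le> (\<Sum>I\<in>(UNIV::('m \<Rightarrow> 'n) set). \<Sum>i\<in>UNIV. x $ i ^ ?m)"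
      by (intro sum_mono prod_le_sum_power[of "($) x"] x)
    then have "(\<Sum>I\<in>(UNIV::('m \<Rightarrow> 'n) set). \<Prod>k\<in>UNIV. x $ I k) \<le> N * (\<Sum>i\<in>UNIV. x $ i ^ ?m)"
      by (simp add: N_def)
    from mult_left_mono[OF this, of "\<delta> n"]
    have "tensor_form (\<lambda>I. c I + \<delta> n) x \<le> tensor_form c x + \<delta> n * (N * (\<Sum>i\<in>UNIV. x $ i ^ ?m))"
      using \<delta>[of n] by (simp add: tensor_form_def distrib_right sum.distrib sum_distrib_left)
    also have "\<dots> \<le> (\<Sum>i\<in>UNIV. d i * x $ i ^ ?m) + \<delta> n * (N * (\<Sum>i\<in>UNIV. x $ i ^ ?m))"
      using nonneg[of x] x by simp
    also have "\<dots> = (\<Sum>i\<in>UNIV. (d i + N * \<delta> n) * x $ i ^ ?m)"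
      by (simp add: algebra_simps sum.distrib sum_distrib_left)
    finally show "tensor_form (\<lambda>I. c I + \<delta> n) x \<le> (\<Sum>i\<in>UNIV. (d i + N * \<delta> n) * x $ i ^ ?m)" .
  qed
  then have "\<exists>b. \<forall>n. (\<forall>I k. 0 \<le> b n I k) \<and> (\<forall>I. (\<Prod>k\<in>UNIV. b n I k) = (c I + \<delta> n) ^ ?m) \<and>
    (\<forall>i. (\<Sum>I\<in>UNIV. \<Sum>k\<in>UNIV. of_bool (I k = i) * b n I k) \<le> ?m * (d i + N * \<delta> n))"
    by (intro choice allI)
  then obtain b where b: "\<And>n I k. 0 \<le> b n I k" "\<And>n I. (\<Prod>k\<in>UNIV. b n I k) = (c I + \<delta> n) ^ ?m"
    "\<And>n i. (\<Sum>I\<in>UNIV. \<Sum>k\<in>UNIV. of_bool (I k = i) * b n I k) \<le> ?m * (d i + N * \<delta> n)"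
    by blast
  define B :: "nat \<Rightarrow> real ^ (('m \<Rightarrow> 'n) \<times> 'm)" where "B n = (\<chi> q. b n (fst q) (snd q))" for n
  \<comment> \<open>Each weight is one term of the sum bounded for \<open>i = I k\<close>; summing
    over all \<open>i\<close> makes the bound independent of \<open>n\<close>, \<open>I\<close> and
    \<open>k\<close>.\<close>
  define C where "C = (\<Sum>i\<in>UNIV. ?m * (\<bar>d i\<bar> + N))"
  have bC: "b n I k \<le> C" for n I k
  proof -
    have N: "0 \<le> N" by (simp add: N_def)
    have "b n I k = of_bool (I k = I k) * b n I k" by simp
    also have "\<dots> \<le> (\<Sum>k'\<in>UNIV. of_bool (I k' = I k) * b n I k')"
      using b(1) by (intro member_le_sum) auto
    also have "\<dots> \<le> (\<Sum>J\<in>UNIV. \<Sum>k'\<in>UNIV. of_bool (J k' = I k) * b n J k')"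
      using b(1) by (intro member_le_sum[of _ _ "\<lambda>J. \<Sum>k'\<in>UNIV. of_bool (J k' = I k) * b n J k'"] sum_nonneg) auto
    also have "\<dots> \<le> ?m * (d (I k) + N * \<delta> n)" by (rule b(3))
    also have "\<dots> \<le> ?m * (\<bar>d (I k)\<bar> + N)"
      using \<delta>[of n] N by (intro mult_left_mono add_mono mult_left_le) auto
    also have "\<dots> \<le> C"
      unfolding C_def using N by (intro member_le_sum[of _ _ "\<lambda>i. ?m * (\<bar>d i\<bar> + N)"]) auto
    finally show ?thesis .
  qed
  have "bounded (range B)"
  proof (rule boundedI)
    fix y assume "y \<in> range B"
    then obtain n where "y = B n" by blast
    then have "\<bar>y $ q\<bar> \<le> C" for q using b(1) bC by (simp add: B_def)
    then have "(\<Sum>q\<in>UNIV. \<bar>y $ q\<bar>) \<le> (\<Sum>q\<in>(UNIV::(('m \<Rightarrow> 'n) \<times> 'm) set). C)" by (intro sum_mono)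
    then show "norm y \<le> (\<Sum>q\<in>(UNIV::(('m \<Rightarrow> 'n) \<times> 'm) set). C)"
      using norm_le_l1_cart[of y] by linarith
  qed
  then obtain L r where r: "strict_mono r" "(B \<circ> r) \<longlonglongrightarrow> L"
    using bounded_imp_convergent_subsequence by blast
  have lim: "(\<lambda>n. b (r n) I k) \<longlonglongrightarrow> L $ (I, k)" for I k
    using tendsto_vec_nth[OF r(2), of "(I, k)"] by (simp add: B_def)
  have \<delta>r: "(\<lambda>n. \<delta> (r n)) \<longlonglongrightarrow> 0"
    using LIMSEQ_subseq_LIMSEQ[OF \<delta>0 r(1)] by (simp add: o_def)
  show ?thesis
  proof (intro exI[of _ "\<lambda>I k. L $ (I, k)"] conjI allI)
    show "0 \<le> L $ (I, k)" for I k
      using lim by (rule LIMSEQ_le_const) (use b(1) in auto)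
    show "(\<Prod>k\<in>UNIV. L $ (I, k)) = c I ^ ?m" for I
    proof (rule LIMSEQ_unique)
      show "(\<lambda>n. \<Prod>k\<in>UNIV. b (r n) I k) \<longlonglongrightarrow> (\<Prod>k\<in>UNIV. L $ (I, k))"
        by (intro tendsto_prod lim)
      have "(\<lambda>n. (c I + \<delta> (r n)) ^ ?m) \<longlonglongrightarrow> (c I + 0) ^ ?m"
        by (intro tendsto_intros \<delta>r)
      then show "(\<lambda>n. \<Prod>k\<in>UNIV. b (r n) I k) \<longlonglongrightarrow> c I ^ ?m" by (simp add: b(2))
    qed
    show "(\<Sum>I\<in>UNIV. \<Sum>k\<in>UNIV. of_bool (I k = i) * L $ (I, k)) \<le> ?m * d i" for i
    proof (rule LIMSEQ_le)
      show "(\<lambda>n. \<Sum>I\<in>UNIV. \<Sum>k\<in>UNIV. of_bool (I k = i) * b (r n) I k)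
          \<longlonglongrightarrow> (\<Sum>I\<in>UNIV. \<Sum>k\<in>UNIV. of_bool (I k = i) * L $ (I, k))"
        by (intro tendsto_sum tendsto_mult tendsto_const lim)
      have "(\<lambda>n. ?m * (d i + N * \<delta> (r n))) \<longlonglongrightarrow> ?m * (d i + N * 0)"
        by (intro tendsto_intros \<delta>r)
      then show "(\<lambda>n. ?m * (d i + N * \<delta> (r n))) \<longlonglongrightarrow> ?m * d i" by simp
    qed (use b(3) in auto)
  qed
qed

section \<open>Assembling the decomposition of the absolute tensor\<close>

text \<open>Diagonal multi-indices are the constant functions, parametrised injectively by their
  value.\<close>

lemma tensor_form_diagonal:
  fixes h :: "('m::finite, 'n::finite) tensor"
  shows "tensor_form (\<lambda>I. if diagonal_index I then h I else 0) x = (\<Sum>i\<in>UNIV. h (\<lambda>_. i) * x $ i ^ CARD('m))"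
proof -
  have "inj (\<lambda>i (_::'m). i :: 'n)" by (auto simp: inj_def fun_eq_iff)
  moreover have "{I :: 'm \<Rightarrow> 'n. diagonal_index I} = range (\<lambda>i _. i)"
    by (auto simp: diagonal_index_def image_iff fun_eq_iff)
  ultimately have "(\<Sum>I | diagonal_index I. h I * (\<Prod>k\<in>UNIV. x $ I k))
      = (\<Sum>i\<in>UNIV. h (\<lambda>_. i) * x $ i ^ CARD('m))"
    by (simp add: sum.reindex)
  moreover have "tensor_form (\<lambda>I. if diagonal_index I then h I else 0) x
      = (\<Sum>I | diagonal_index I. h I * (\<Prod>k\<in>UNIV. x $ I k))"
    unfolding tensor_form_def by (rule sum.mono_neutral_cong_right) auto
  ultimately show ?thesis by simp
qed

theorem theorem3p3:
  fixes A :: "('m::finite, 'n::finite) tensor"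
  assumes "even CARD('m)"
    and "symmetric_tensor A"
    and "Z_tensor A"
    and "psd_tensor A"
  shows "has_sos_decomposition (abs_tensor A)"
proof -
  let ?m = "CARD('m)"
  define c where "c = neg_offdiag_part A"
  define d where "d i = A (\<lambda>_. i)" for i
  have "0 < ?m" by simp
  then have m: "2 \<le> ?m" using assms(1) by (intro dvd_imp_le)
  have c: "0 \<le> c I" for I
    using assms(3) by (auto simp: c_def neg_offdiag_part_def diag_part_def Z_tensor_def)
  have form: "tensor_form A x = (\<Sum>i\<in>UNIV. d i * x $ i ^ ?m) - tensor_form c x" for x
  proof -
    have "tensor_form A x = tensor_form (diag_part A) x - tensor_form c x"
      by (simp add: tensor_form_def c_def neg_offdiag_part_def left_diff_distrib sum_subtractf)
    then show ?thesis by (simp add: diag_part_def tensor_form_diagonal d_def)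
  qed
  have abs_form: "tensor_form (abs_tensor A) x = (\<Sum>i\<in>UNIV. \<bar>d i\<bar> * x $ i ^ ?m) + tensor_form c x" for x
  proof -
    have "tensor_form (abs_tensor A) x = tensor_form (\<lambda>I. if diagonal_index I then \<bar>A I\<bar> else 0) x + tensor_form c x"
    proof -
      have "abs_tensor A = (\<lambda>I. (if diagonal_index I then \<bar>A I\<bar> else 0) + c I)"
        by (auto simp: c_def abs_tensor_def diag_part_def)
      then show ?thesis by (simp add: tensor_form_def distrib_right sum.distrib)
    qed
    then show ?thesis by (simp add: tensor_form_diagonal d_def)
  qed
  have "tensor_form c x \<le> (\<Sum>i\<in>UNIV. d i * x $ i ^ ?m)" for x
    using assms(4)[unfolded psd_tensor_def, rule_format, of x] form[of x] by linarith
  from weights_of_nonneg_tensor[OF m c this] obtain b where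
    b: "\<And>I k. 0 \<le> b I k" "\<And>I. (\<Prod>k\<in>UNIV. b I k) = c I ^ ?m"
    "\<And>i. (\<Sum>I\<in>UNIV. \<Sum>k\<in>UNIV. of_bool (I k = i) * b I k) \<le> ?m * d i"
    by blast
  define s where "s i = (\<Sum>I\<in>UNIV. \<Sum>k\<in>UNIV. of_bool (I k = i) * b I k)" for i
  define y where "y I k x = root ?m (b I k) * x $ I k" for I k and x :: "real ^ 'n"
  have coord: "real_polynomial_function (\<lambda>x :: real ^ 'n. x $ i)" for i
    by (intro real_polynomial_function.intros(1) bounded_linear_vec_nth)
  have y: "real_polynomial_function (y I k)" for I k
    unfolding y_def by (intro real_polynomial_function.intros(2-) coord)
  have "(\<lambda>x::real^'n. x $ i ^ ?m) \<in> sos" for i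
  proof -
    obtain h where "?m = 2 * h" using assms(1) by blast
    then show ?thesis
      using sos_power[OF sos_square[OF coord[of i]], of h] by (simp add: power_mult)
  qed
  moreover have "0 \<le> \<bar>d i\<bar> - s i / ?m" for i
  proof -
    have "s i \<le> ?m * d i" using b(3)[of i] by (simp only: s_def)
    also have "\<dots> \<le> ?m * \<bar>d i\<bar>" by (intro mult_left_mono) auto
    finally show ?thesis by (simp add: divide_le_eq mult.commute)
  qed
  ultimately have sos: "(\<lambda>x. (\<Sum>i\<in>UNIV. (\<bar>d i\<bar> - s i / ?m) * x $ i ^ ?m)
      + (\<Sum>I\<in>UNIV. (\<Sum>k\<in>UNIV. y I k x ^ ?m) / ?m + (\<Prod>k\<in>UNIV. y I k x))) \<in> sos"
    using assms(1) y by (intro sos_add sos_sum sos_cmult sos_mean_add_prod)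
  have eq: "(\<Sum>i\<in>UNIV. (\<bar>d i\<bar> - s i / ?m) * x $ i ^ ?m)
      + (\<Sum>I\<in>UNIV. (\<Sum>k\<in>UNIV. y I k x ^ ?m) / ?m + (\<Prod>k\<in>UNIV. y I k x))
      = tensor_form (abs_tensor A) x" for x
  proof -
    have power: "y I k x ^ ?m = b I k * x $ I k ^ ?m" for I k
      using b(1) by (simp add: y_def power_mult_distrib)
    \<comment> \<open>Both sides are nonnegative, so equality of their \<open>?m\<close>-th powers
      suffices.\<close>
    have "(\<Prod>k\<in>UNIV. root ?m (b I k)) = c I" for I
    proof -
      have "(\<Prod>k\<in>UNIV. root ?m (b I k)) ^ ?m = c I ^ ?m"
        using b(1,2) by (simp add: prod_power_distrib)
      then show ?thesis
        by (rule power_eq_imp_eq_base) (simp_all add: prod_nonneg b(1) c)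
    qed
    then have prod: "(\<Prod>k\<in>UNIV. y I k x) = c I * (\<Prod>k\<in>UNIV. x $ I k)" for I
      by (simp add: y_def prod.distrib)
    \<comment> \<open>Double counting: the weights grouped by coordinate are regrouped by
      multi-index.\<close>
    have "(\<Sum>i\<in>UNIV. s i * x $ i ^ ?m)
        = (\<Sum>i\<in>UNIV. \<Sum>I\<in>UNIV. \<Sum>k\<in>UNIV. of_bool (I k = i) * b I k * x $ i ^ ?m)"
      by (simp only: s_def sum_distrib_right)
    also have "\<dots> = (\<Sum>I\<in>UNIV. \<Sum>i\<in>UNIV. \<Sum>k\<in>UNIV. of_bool (I k = i) * b I k * x $ i ^ ?m)"
      by (rule sum.swap)
    also have "\<dots> = (\<Sum>I\<in>UNIV. \<Sum>k\<in>UNIV. \<Sum>i\<in>UNIV. of_bool (I k = i) * b I k * x $ i ^ ?m)"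
      by (intro sum.cong refl sum.swap)
    also have "\<dots> = (\<Sum>I\<in>UNIV. \<Sum>k\<in>UNIV. b I k * x $ I k ^ ?m)"
      by (simp add: of_bool_def if_distrib if_distribR cong: if_cong)
    finally have s: "(\<Sum>i\<in>UNIV. s i * x $ i ^ ?m) = (\<Sum>I\<in>UNIV. \<Sum>k\<in>UNIV. b I k * x $ I k ^ ?m)" .
    show ?thesis
      unfolding abs_form power prod
      by (simp add: left_diff_distrib sum_subtractf sum.distrib tensor_form_def s flip: sum_divide_distrib)
  qed
  show ?thesis
    using sos_imp_sum_squares[OF sos] unfolding eq has_sos_decomposition_def by blast
qed

end
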